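(* Let $R$ be a regular quantum commutative algebra of quantum length $m$. Then $R$ is a PI-algebra.
   Context: $K$ is an algebraically closed field of characteristic different from $2$; all algebras are unital associative $K$-algebras (not assumed finite-dimensional). A regular quantum commutative decomposition of an algebra $R$, of quantum length $m$, is a vector space decomposition $R=R_1\oplus\cdots\oplus R_m$ such that, with $S=\{1,\dots,m\}$: (a) for every $n\in\mathbb{N}$ and every $(i_1,\dots,i_n)\in S^n$ there exist $a_j\in R_{i_j}$, $1\le j\le n$, with $a_1\cdots a_n\neq 0$; (b) there is a function $\theta\colon S\times S\to K^*$ such that $ab=\theta(i,j)ba$ for all $i,j\in S$, $a\in R_i$, $b\in R_j$. An algebra with a fixed such decomposition and $\theta$ is called a regular quantum commutative algebra. $R$ is a PI-algebra if there is a nonzero polynomial $f(x_1,\dots,x_n)$ in the free associative algebra $K\langle x_1,x_2,\dots\rangle$ such that $f(r_1,\dots,r_n)=0$ for all $r_1,\dots,r_n\in R$. *)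

theory Defs
  imports
    "HOL-Computational_Algebra.Polynomial"
    "HOL-Library.Poly_Mapping"
    "HOL-Library.FuncSet"
begin

(* The sort {ring, monoid_mult} is a unital ring in which 1 = 0 is not excluded. *)
locale unital_algebra = vector_space scale
  for scale :: "'k::field \<Rightarrow> 'r::{ring,monoid_mult} \<Rightarrow> 'r"  (infixr \<open>*s\<close> 75) +
  assumes scale_mult_left: "(c *s a) * b = c *s (a * b)"
    and scale_mult_right: "a * (c *s b) = c *s (a * b)"

(* Words in the letters 0, 1, 2, ... under concatenation. The monoid is written additively
   because Poly_Mapping takes its convolution product over an additive monoid. *)
datatype fword = FWord (letters: "nat list")

instantiation fword :: monoid_add
begin

definition zero_fword :: fword where
  "zero_fword = FWord []"

definition plus_fword :: "fword \<Rightarrow> fword \<Rightarrow> fword" where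
  "plus_fword u v = FWord (letters u @ letters v)"

instance
  by standard (simp_all add: zero_fword_def plus_fword_def)

end

(* The monoid algebra of the word monoid, with its ring structure from Poly_Mapping.
   The letter i stands for the variable x_(i+1). *)
type_synonym 'k free_algebra = "fword \<Rightarrow>\<^sub>0 'k"

context unital_algebra
begin

definition eval_word :: "(nat \<Rightarrow> 'r) \<Rightarrow> fword \<Rightarrow> 'r" where
  "eval_word r w = prod_list (map r (letters w))"

definition eval_free :: "(nat \<Rightarrow> 'r) \<Rightarrow> 'k free_algebra \<Rightarrow> 'r" where
  "eval_free r f = (\<Sum>w\<in>Poly_Mapping.keys f. Poly_Mapping.lookup f w *s eval_word r w)"

(* An element f of the free algebra involves finitely many variables, and eval_free r f depends
   only on the values of r at these, so quantifying over all sequences r amounts to quantifying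
   over the tuples of values of the variables of f. *)
definition PI_algebra :: bool where
  "PI_algebra \<longleftrightarrow> (\<exists>f :: 'k free_algebra. f \<noteq> 0 \<and> (\<forall>r. eval_free r f = 0))"

definition direct_sum_decomposition :: "nat \<Rightarrow> (nat \<Rightarrow> 'r set) \<Rightarrow> bool" where
  "direct_sum_decomposition m R \<longleftrightarrow>
     (\<forall>i\<in>{1..m}. subspace (R i)) \<and>
     (\<forall>x. \<exists>!a. a \<in> (\<Pi>\<^sub>E i\<in>{1..m}. R i) \<and> x = (\<Sum>i\<in>{1..m}. a i))"

end

locale regular_quantum_commutative_algebra = unital_algebra scale
  for scale :: "'k::field \<Rightarrow> 'r::{ring,monoid_mult} \<Rightarrow> 'r"  (infixr \<open>*s\<close> 75) +
  fixes m :: nat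
    and R :: "nat \<Rightarrow> 'r set"
    and \<theta> :: "nat \<Rightarrow> nat \<Rightarrow> 'k"
  assumes decomposition: "direct_sum_decomposition m R"
    and regular: "\<And>is. is \<noteq> [] \<Longrightarrow> set is \<subseteq> {1..m} \<Longrightarrow>
          \<exists>as. list_all2 (\<lambda>i a. a \<in> R i) is as \<and> prod_list as \<noteq> 0"
    and theta_nonzero: "\<And>i j. i \<in> {1..m} \<Longrightarrow> j \<in> {1..m} \<Longrightarrow> \<theta> i j \<noteq> 0"
    and quantum_commutative: "\<And>i j a b. i \<in> {1..m} \<Longrightarrow> j \<in> {1..m} \<Longrightarrow> a \<in> R i \<Longrightarrow> b \<in> R j \<Longrightarrow>
          a * b = \<theta> i j *s (b * a)"

end

theory Submission
  imports Defs "HOL-Combinatorics.Multiset_Permutations"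
begin

text \<open>
  The proof is a dimension count of the kind that Regev made for codimensions. Consider the
  multilinear polynomials of degree \<open>n\<close>, that is, the linear combinations of the \<open>n!\<close>
  words in which each of \<open>n\<close> letters occurs once. By multilinearity (\<open>prod_list_sum_expand\<close>),
  such a polynomial is an identity as soon as it vanishes when every letter is given a value in
  one of the components \<open>R 1, \<dots>, R m\<close>. There are \<open>m ^ n\<close> ways to assign components to the
  letters. For each of them, quantum commutativity lets the factors of every word be sorted into
  one fixed order at the cost of a scalar that depends on the word and on the assignment, but not
  on the values (\<open>prod_list_reorder\<close>). The value of the polynomial is therefore a multiple
  of the product in the fixed order, and the factor is a linear form in the coefficients, one form
  for each assignment. When \<open>n\<close> is so large that \<open>m ^ n < n!\<close>
  (\<open>exists_power_less_fact\<close>), these forms are fewer than the coefficients, so they have a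
  common nonzero root (\<open>exists_nontrivial_solution\<close>), which is a polynomial identity.
\<close>

section \<open>Counting and linear algebra\<close>

text \<open>
  Gaussian elimination of one equation at a time: an equation with a nonzero coefficient
  determines one unknown from the others, so it is removed together with that unknown.
\<close>

lemma exists_nontrivial_solution:
  fixes c :: "'a \<Rightarrow> 'b \<Rightarrow> 'k::field"
  assumes "finite B" "finite A" "card B < card A"
  shows "\<exists>\<alpha>. (\<exists>a\<in>A. \<alpha> a \<noteq> 0) \<and> (\<forall>b\<in>B. (\<Sum>a\<in>A. \<alpha> a * c a b) = 0)"
  using assms
proof (induction B arbitrary: A c rule: finite_induct)
  case empty
  then obtain a where "a \<in> A" by fastforce
  then show ?case by (intro exI[of _ "\<lambda>_. 1"]) auto
next
  case (insert b B)
  show ?case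
  proof (cases "\<forall>a\<in>A. c a b = 0")
    case True
    have "card B < card A" using insert by simp
    from insert.IH[OF \<open>finite A\<close> this, of c] True show ?thesis by auto
  next
    case False
    then obtain p where p: "p \<in> A" "c p b \<noteq> 0" by blast
    define A' where "A' = A - {p}"
    have A': "finite A'" "p \<notin> A'" "A = insert p A'" using insert p by (auto simp: A'_def)
    have "card B < card A'" using insert A' by simp
    from insert.IH[OF \<open>finite A'\<close> this, of "\<lambda>a b'. c a b' - c a b / c p b * c p b'"]
    obtain \<alpha> where nz: "\<exists>a\<in>A'. \<alpha> a \<noteq> 0"
      and eqs: "\<And>b'. b' \<in> B \<Longrightarrow> (\<Sum>a\<in>A'. \<alpha> a * (c a b' - c a b / c p b * c p b')) = 0"
      by blast
    define \<beta> where "\<beta> = \<alpha>(p := - (\<Sum>a\<in>A'. \<alpha> a * c a b) / c p b)"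
    have sum_\<beta>: "(\<Sum>a\<in>A. \<beta> a * c a b') =
        - (\<Sum>a\<in>A'. \<alpha> a * c a b) / c p b * c p b' + (\<Sum>a\<in>A'. \<alpha> a * c a b')" for b'
    proof -
      have "(\<Sum>a\<in>A'. \<beta> a * c a b') = (\<Sum>a\<in>A'. \<alpha> a * c a b')"
        using A' by (intro sum.cong) (auto simp: \<beta>_def)
      then show ?thesis using A' by (simp add: \<beta>_def)
    qed
    have "(\<Sum>a\<in>A. \<beta> a * c a b') = (\<Sum>a\<in>A'. \<alpha> a * (c a b' - c a b / c p b * c p b'))" for b'
      unfolding sum_\<beta>
      by (simp add: algebra_simps sum_subtractf sum_distrib_left sum_divide_distrib)
    with eqs have "(\<Sum>a\<in>A. \<beta> a * c a b') = 0" if "b' \<in> B" for b'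
      using that by simp
    moreover have "(\<Sum>a\<in>A. \<beta> a * c a b) = 0"
      unfolding sum_\<beta> using p by simp
    moreover have "\<exists>a\<in>A. \<beta> a \<noteq> 0"
      using nz A' by (auto simp: \<beta>_def)
    ultimately show ?thesis by blast
  qed
qed

lemma Suc_power_le_fact: "Suc N ^ j \<le> fact (N + j)"
proof (induction j)
  case (Suc j)
  have "Suc N * Suc N ^ j \<le> Suc (N + j) * fact (N + j)"
    by (intro mult_le_mono Suc.IH) simp
  then show ?case by simp
qed (simp add: Suc_le_eq)

lemma exists_power_less_fact: "\<exists>n. (m::nat) ^ n < fact n"
proof -
  define N where "N = Suc (m ^ 2)"
  \<comment> \<open>The upper half of the factors of \<open>(2 * N)!\<close> alone beats the power, since each exceeds \<open>m\<^sup>2\<close>.\<close>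
  have "m ^ (N + N) = (m ^ 2) ^ N"
    by (simp add: mult_2 flip: power_mult)
  also have "\<dots> < Suc N ^ N"
    by (intro power_strict_mono) (auto simp: N_def)
  also have "\<dots> \<le> fact (N + N)"
    by (rule Suc_power_le_fact)
  finally show ?thesis by blast
qed

section \<open>Evaluation of multilinear polynomials\<close>

text \<open>
  Each factor of a product over a distinct list may be chosen independently; distinctness is what
  makes the choices a function of the list entries.
\<close>

lemma prod_list_sum_expand:
  fixes a :: "'a \<Rightarrow> 'b \<Rightarrow> 'r::{ring,monoid_mult}"
  assumes "distinct xs" "finite S"
  shows "prod_list (map (\<lambda>k. \<Sum>j\<in>S. a k j) xs) =
    (\<Sum>i\<in>set xs \<rightarrow>\<^sub>E S. prod_list (map (\<lambda>k. a k (i k)) xs))"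
  using assms(1)
proof (induction xs)
  case (Cons x xs)
  have "(\<Sum>i\<in>set (x # xs) \<rightarrow>\<^sub>E S. prod_list (map (\<lambda>k. a k (i k)) (x # xs)))
      = (\<Sum>(j, i)\<in>S \<times> (set xs \<rightarrow>\<^sub>E S).
          prod_list (map (\<lambda>k. a k ((i(x := j)) k)) (x # xs)))"
  proof -
    have "inj_on (\<lambda>(j, i). i(x := j)) (S \<times> (set xs \<rightarrow>\<^sub>E S))"
      using Cons.prems by (intro inj_combinator) simp
    then show ?thesis
      unfolding list.set(2) PiE_insert_eq by (subst sum.reindex) (auto simp: case_prod_unfold)
  qed
  also have "\<dots> = (\<Sum>(j, i)\<in>S \<times> (set xs \<rightarrow>\<^sub>E S). a x j * prod_list (map (\<lambda>k. a k (i k)) xs))"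
  proof (intro sum.cong refl, clarify)
    fix j i
    have "map (\<lambda>k. a k ((i(x := j)) k)) xs = map (\<lambda>k. a k (i k)) xs"
      using Cons.prems by auto
    then show "prod_list (map (\<lambda>k. a k ((i(x := j)) k)) (x # xs)) =
        a x j * prod_list (map (\<lambda>k. a k (i k)) xs)"
      by (metis fun_upd_same list.simps(9) prod_list.Cons)
  qed
  also have "\<dots> = (\<Sum>j\<in>S. a x j) * (\<Sum>i\<in>set xs \<rightarrow>\<^sub>E S. prod_list (map (\<lambda>k. a k (i k)) xs))"
    by (simp add: sum_product sum.cartesian_product)
  finally show ?case using Cons by simp
qed simp

definition word_combination :: "nat list set \<Rightarrow> (nat list \<Rightarrow> 'k::field) \<Rightarrow> 'k free_algebra" where
  "word_combination A \<alpha> = (\<Sum>xs\<in>A. Poly_Mapping.single (FWord xs) (\<alpha> xs))"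

lemma lookup_word_combination:
  assumes "finite A"
  shows "Poly_Mapping.lookup (word_combination A \<alpha>) w = (if letters w \<in> A then \<alpha> (letters w) else 0)"
proof -
  have "Poly_Mapping.lookup (word_combination A \<alpha>) w
      = (\<Sum>xs\<in>A. if xs = letters w then \<alpha> xs else 0)"
    unfolding word_combination_def lookup_sum
    by (intro sum.cong) (auto simp: lookup_single when_def)
  then show ?thesis using assms by simp
qed

lemma (in unital_algebra) eval_word_combination:
  assumes "finite A"
  shows "eval_free r (word_combination A \<alpha>) = (\<Sum>xs\<in>A. \<alpha> xs *s prod_list (map r xs))"
proof -
  let ?f = "word_combination A \<alpha>"
  have "eval_free r ?f = (\<Sum>w\<in>FWord ` A. Poly_Mapping.lookup ?f w *s eval_word r w)"
    unfolding eval_free_def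
  proof (rule sum.mono_neutral_left)
    show "Poly_Mapping.keys ?f \<subseteq> FWord ` A"
    proof
      fix w assume "w \<in> Poly_Mapping.keys ?f"
      then have "letters w \<in> A"
        using assms by (auto simp: in_keys_iff lookup_word_combination split: if_splits)
      then show "w \<in> FWord ` A" by (metis fword.collapse imageI)
    qed
  qed (use assms in \<open>auto simp: in_keys_iff\<close>)
  also have "\<dots> = (\<Sum>xs\<in>A. \<alpha> xs *s prod_list (map r xs))"
    using assms by (simp add: sum.reindex inj_on_def lookup_word_combination eval_word_def)
  finally show ?thesis .
qed

section \<open>Reordering products of homogeneous elements\<close>

context regular_quantum_commutative_algebra
begin

lemma prod_list_move_factor:
  assumes "i x \<in> {1..m}" "i ` set u \<subseteq> {1..m}" "r x \<in> R (i x)" "\<forall>k\<in>set u. r k \<in> R (i k)"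
  shows "r x * prod_list (map r u) =
    prod_list (map (\<lambda>k. \<theta> (i x) (i k)) u) *s (prod_list (map r u) * r x)"
  using assms(2,4)
proof (induction u)
  case (Cons k u)
  let ?t = "\<theta> (i x) (i k)" and ?P = "prod_list (map r u)"
  have "r x * (r k * ?P) = ?t *s (r k * (r x * ?P))"
    using quantum_commutative[of "i x" "i k" "r x" "r k"] assms Cons.prems
    by (simp add: scale_mult_left mult.assoc flip: mult.assoc[of "r x" "r k"])
  then show ?case
    using Cons by (simp add: scale_mult_right mult.assoc)
qed simp

text \<open>
  The factor that has to come first is moved to the front, and the rest is reordered in the same
  way. The quantifier over the values \<open>r\<close> stands inside that over the scalar: the scalar may depend only
  on the components to which the factors belong, for otherwise the linear equations that the
  coefficients of an identity have to satisfy would be infinite in number.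
\<close>

lemma prod_list_reorder:
  assumes "mset xs = mset ys" "i ` set xs \<subseteq> {1..m}"
  shows "\<exists>c. \<forall>r. (\<forall>k\<in>set xs. r k \<in> R (i k)) \<longrightarrow>
    prod_list (map r ys) = c *s prod_list (map r xs)"
  using assms
proof (induction ys arbitrary: xs)
  case Nil
  then show ?case by (intro exI[of _ 1]) simp
next
  case (Cons y ys)
  then have "y \<in> set xs" by (metis list.set_intros(1) mset_eq_setD)
  then obtain u v where xs: "xs = u @ y # v" by (meson split_list)
  have "mset (u @ v) = mset ys" "i ` set (u @ v) \<subseteq> {1..m}"
    using Cons.prems by (auto simp: xs)
  from Cons.IH[OF this] obtain c where
    c: "\<And>r. \<forall>k\<in>set (u @ v). r k \<in> R (i k) \<Longrightarrow>
          prod_list (map r ys) = c *s prod_list (map r (u @ v))"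
    by blast
  define t where "t = prod_list (map (\<lambda>k. \<theta> (i y) (i k)) u)"
  have "prod_list (map r (y # ys)) = (c * t) *s prod_list (map r xs)"
    if r: "\<forall>k\<in>set xs. r k \<in> R (i k)" for r
  proof -
    let ?U = "prod_list (map r u)" and ?V = "prod_list (map r v)"
    have "prod_list (map r (y # ys)) = c *s ((r y * ?U) * ?V)"
      using c[of r] r by (simp add: xs scale_mult_right mult.assoc)
    also have "r y * ?U = t *s (?U * r y)"
      unfolding t_def using Cons.prems r by (intro prod_list_move_factor) (auto simp: xs)
    finally show ?thesis by (simp add: xs scale_mult_left mult.assoc)
  qed
  then show ?case by blast
qed

lemma exists_homogeneous_components:
  "\<exists>a. (\<forall>j\<in>{1..m}. a j \<in> R j) \<and> x = (\<Sum>j\<in>{1..m}. a j)"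
proof -
  have "\<exists>!a. a \<in> (\<Pi>\<^sub>E j\<in>{1..m}. R j) \<and> x = (\<Sum>j\<in>{1..m}. a j)"
    using decomposition unfolding direct_sum_decomposition_def by blast
  then obtain a where "a \<in> (\<Pi>\<^sub>E j\<in>{1..m}. R j)" "x = (\<Sum>j\<in>{1..m}. a j)"
    by blast
  then show ?thesis by (intro exI[of _ a]) auto
qed

section \<open>The polynomial identity\<close>

theorem PI_algebra: PI_algebra
proof -
  obtain n :: nat where n: "m ^ n < fact n"
    using exists_power_less_fact by blast
  define A where "A = permutations_of_set {..<n}"
  define B where "B = ({..<n} \<rightarrow>\<^sub>E {1..m})"
  have fin: "finite A" "finite B"
    by (auto simp: A_def B_def finite_PiE)
  have A: "distinct xs" "set xs = {..<n}" if "xs \<in> A" for xs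
    using that by (auto simp: A_def permutations_of_set_def)
  have "card B < card A"
    using n by (simp add: A_def B_def card_PiE)
  have "\<exists>c. \<forall>r. (\<forall>k<n. r k \<in> R (i k)) \<longrightarrow>
      prod_list (map r xs) = c *s prod_list (map r [0..<n])"
    if "xs \<in> A" "i \<in> B" for xs i
  proof -
    have "mset [0..<n] = mset xs"
      using set_eq_iff_mset_eq_distinct[of "[0..<n]" xs] A[OF that(1)]
      by (simp add: atLeast0LessThan)
    moreover have "i ` set [0..<n] \<subseteq> {1..m}"
      using PiE_mem[OF that(2)[unfolded B_def]] by fastforce
    ultimately obtain c where "\<forall>r. (\<forall>k\<in>set [0..<n]. r k \<in> R (i k)) \<longrightarrow>
        prod_list (map r xs) = c *s prod_list (map r [0..<n])"
      using prod_list_reorder by blast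
    then show ?thesis
      by (intro exI[of _ c]) simp
  qed
  then obtain c where c: "\<And>xs i r. xs \<in> A \<Longrightarrow> i \<in> B \<Longrightarrow> \<forall>k<n. r k \<in> R (i k) \<Longrightarrow>
      prod_list (map r xs) = c xs i *s prod_list (map r [0..<n])"
    by metis
  from exists_nontrivial_solution[OF fin(2,1) \<open>card B < card A\<close>, of c]
  obtain \<alpha> where nz: "\<exists>xs\<in>A. \<alpha> xs \<noteq> 0"
    and eqs: "\<And>i. i \<in> B \<Longrightarrow> (\<Sum>xs\<in>A. \<alpha> xs * c xs i) = 0"
    by blast
  have "eval_free r (word_combination A \<alpha>) = 0" for r
  proof -
    have "\<forall>k. \<exists>b. (\<forall>j\<in>{1..m}. b j \<in> R j) \<and> r k = (\<Sum>j\<in>{1..m}. b j)"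
      by (intro allI exists_homogeneous_components)
    from choice[OF this] obtain a where
      a: "\<And>k j. j \<in> {1..m} \<Longrightarrow> a k j \<in> R j" "\<And>k. r k = (\<Sum>j\<in>{1..m}. a k j)"
      by blast
    define P where "P i = prod_list (map (\<lambda>k. a k (i k)) [0..<n])" for i
    have "prod_list (map r xs) = (\<Sum>i\<in>B. c xs i *s P i)" if "xs \<in> A" for xs
    proof -
      have "prod_list (map r xs) = (\<Sum>i\<in>B. prod_list (map (\<lambda>k. a k (i k)) xs))"
        using prod_list_sum_expand[of xs "{1..m}" a] A[OF that]
        by (simp add: B_def a(2)[abs_def])
      also have "\<dots> = (\<Sum>i\<in>B. c xs i *s P i)"
      proof (rule sum.cong[OF refl])
        fix i assume i: "i \<in> B"
        then have "\<forall>k<n. a k (i k) \<in> R (i k)"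
          unfolding B_def by (metis PiE_mem a(1) lessThan_iff)
        then show "prod_list (map (\<lambda>k. a k (i k)) xs) = c xs i *s P i"
          unfolding P_def by (rule c[OF that i])
      qed
      finally show ?thesis .
    qed
    then have "eval_free r (word_combination A \<alpha>) = (\<Sum>xs\<in>A. \<Sum>i\<in>B. (\<alpha> xs * c xs i) *s P i)"
      using fin by (simp add: eval_word_combination scale_sum_right)
    also have "\<dots> = (\<Sum>i\<in>B. (\<Sum>xs\<in>A. \<alpha> xs * c xs i) *s P i)"
      by (subst sum.swap) (simp add: scale_sum_left)
    also have "\<dots> = 0"
      by (simp add: eqs)
    finally show ?thesis .
  qed
  moreover have "word_combination A \<alpha> \<noteq> 0"
  proof -
    from nz obtain xs where "xs \<in> A" "\<alpha> xs \<noteq> 0" by blast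
    then have "Poly_Mapping.lookup (word_combination A \<alpha>) (FWord xs) \<noteq> 0"
      using fin by (simp add: lookup_word_combination)
    then show ?thesis by auto
  qed
  ultimately show ?thesis
    unfolding PI_algebra_def by blast
qed

end

theorem proposition25:
  fixes scale :: "'k::alg_closed_field \<Rightarrow> 'r::{ring,monoid_mult} \<Rightarrow> 'r"
    and m :: nat
    and R :: "nat \<Rightarrow> 'r set"
    and \<theta> :: "nat \<Rightarrow> nat \<Rightarrow> 'k"
  assumes "CHAR('k) \<noteq> 2"
    and "regular_quantum_commutative_algebra scale m R \<theta>"
  shows "unital_algebra.PI_algebra scale"
  using assms(2) by (rule regular_quantum_commutative_algebra.PI_algebra)

end
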